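(* Let $\varepsilon\in(0,1)$, let $\mathscr{X}$ be an arbitrary nonempty set, let $\mathscr{S}$ be the set of quantum states on a finite-dimensional Hilbert space, and let $\mathcal{W}:\mathscr{X}\to\mathscr{S}$ be an arbitrary function (a classical-quantum channel). For any $\mu\in(0,1-\varepsilon)$, $$\log M^*(\mathcal{W},\varepsilon)\le\chi_h^{\varepsilon+\mu}\big(\overline{\operatorname{im}(\mathcal{W})}\big)+\log\frac{\varepsilon+\mu}{\mu(1-\varepsilon-\mu)}.$$
   Context: Quantum states are positive semidefinite trace-one operators; $\operatorname{im}(\mathcal{W})=\{\mathcal{W}(x):x\in\mathscr{X}\}$ and $\overline{\,\cdot\,}$ is closure in trace distance. A code $\mathcal{C}=\{\mathscr{M},e,\mathcal{D}\}$ for $\mathcal{W}$ consists of a finite message set $\mathscr{M}$, an encoder $e:\mathscr{M}\to\mathscr{X}$ and a POVM $\mathcal{D}=\{Q_m\}_{m\in\mathscr{M}}$ ($Q_m\ge0$, $\sum_mQ_m=\mathrm{id}$); $|\mathcal{C}|=|\mathscr{M}|$ and $p_{\rm err}(\mathcal{C},\mathcal{W})=1-\frac1{|\mathscr{M}|}\sum_m\operatorname{tr}(\mathcal{W}(e(m))Q_m)$. $M^*(\mathcal{W},\varepsilon)$ is the largest $m\in\mathbb{N}$ such that a code with $|\mathcal{C}|=m$ and $p_{\rm err}(\mathcal{C},\mathcal{W})\le\varepsilon$ exists. For $\varepsilon\in(0,1)$ and states $\rho,\sigma$, the $\varepsilon$-hypothesis-testing divergence is $D_h^\varepsilon(\rho\|\sigma)=-\log\frac{\beta_{1-\varepsilon}(\rho\|\sigma)}{1-\varepsilon}$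 with $\beta_{1-\varepsilon}(\rho\|\sigma)=\min\{\operatorname{tr}(Q\sigma):0\le Q\le\mathrm{id},\ \operatorname{tr}(Q\rho)\ge1-\varepsilon\}$ (value $+\infty$ if $\beta_{1-\varepsilon}=0$). For $\mathscr{S}_\circ\subseteq\mathscr{S}$, $\chi_h^\varepsilon(\mathscr{S}_\circ)=\inf_{\sigma\in\mathscr{S}}\sup_{\rho\in\mathscr{S}_\circ}D_h^\varepsilon(\rho\|\sigma)$. *)

theory Defs
  imports "HOL-Analysis.Analysis"
begin

text \<open>Operators on an arbitrary finite-dimensional Hilbert space are represented, in an orthonormal
  basis, by matrices of type \<^typ>\<open>complex ^ 'n ^ 'n\<close>. The inner product of the library on
  \<^typ>\<open>complex ^ 'n\<close> is the real one, hence the separate sesquilinear form.\<close>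

definition cinner :: "complex ^ 'n \<Rightarrow> complex ^ 'n \<Rightarrow> complex" where
  "cinner v w = (\<Sum>i\<in>UNIV. cnj (v $ i) * w $ i)"

definition cadjoint :: "complex ^ 'n ^ 'n \<Rightarrow> complex ^ 'n ^ 'n" where
  "cadjoint A = (\<chi> i j. cnj (A $ j $ i))"

text \<open>Over the complex numbers, a form that takes only nonnegative real values is automatically
  Hermitian.\<close>

definition psd :: "complex ^ 'n ^ 'n \<Rightarrow> bool" where
  "psd A \<longleftrightarrow> (\<forall>v. cinner v (A *v v) \<in> \<real>\<^sub>\<ge>\<^sub>0)"

definition states :: "(complex ^ 'n ^ 'n) set" where
  "states = {\<rho>. psd \<rho> \<and> trace \<rho> = 1}"

text \<open>Every positive semidefinite matrix has exactly one positive semidefinite square root, so the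
  description below denotes it.\<close>

definition psd_sqrt :: "complex ^ 'n ^ 'n \<Rightarrow> complex ^ 'n ^ 'n" where
  "psd_sqrt A = (THE B. psd B \<and> B ** B = A)"

definition trace_norm :: "complex ^ 'n ^ 'n \<Rightarrow> real" where
  "trace_norm A = Re (trace (psd_sqrt (cadjoint A ** A)))"

definition trace_dist :: "complex ^ 'n ^ 'n \<Rightarrow> complex ^ 'n ^ 'n \<Rightarrow> real" where
  "trace_dist \<rho> \<sigma> = trace_norm (\<rho> - \<sigma>) / 2"

text \<open>Closure of a set of states, taken in the metric space of all states.\<close>

definition state_closure :: "(complex ^ 'n ^ 'n) set \<Rightarrow> (complex ^ 'n ^ 'n) set" where
  "state_closure S = {\<rho> \<in> states. \<forall>r>0. \<exists>\<tau>\<in>S. trace_dist \<rho> \<tau> < r}"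

text \<open>A code has messages \<open>M\<close>, encoder \<open>e\<close> and decoding POVM \<open>Q\<close>; the values of \<open>e\<close> and \<open>Q\<close>
  outside \<open>M\<close> are irrelevant.\<close>

definition is_povm :: "'m set \<Rightarrow> ('m \<Rightarrow> complex ^ 'n ^ 'n) \<Rightarrow> bool" where
  "is_povm M Q \<longleftrightarrow> (\<forall>m\<in>M. psd (Q m)) \<and> (\<Sum>m\<in>M. Q m) = mat 1"

definition is_code ::
  "'x set \<Rightarrow> 'm set \<Rightarrow> ('m \<Rightarrow> 'x) \<Rightarrow> ('m \<Rightarrow> complex ^ 'n ^ 'n) \<Rightarrow> bool" where
  "is_code X M e Q \<longleftrightarrow> finite M \<and> M \<noteq> {} \<and> e \<in> M \<rightarrow> X \<and> is_povm M Q"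

text \<open>Traces of products of two positive semidefinite matrices are real, so \<^const>\<open>Re\<close> only
  changes the type, here and below.\<close>

definition p_err ::
  "('x \<Rightarrow> complex ^ 'n ^ 'n) \<Rightarrow> 'm set \<Rightarrow> ('m \<Rightarrow> 'x) \<Rightarrow> ('m \<Rightarrow> complex ^ 'n ^ 'n) \<Rightarrow> real" where
  "p_err W M e Q = 1 - 1 / real (card M) * (\<Sum>m\<in>M. Re (trace (W (e m) ** Q m)))"

text \<open>Any finite message set is in bijection with a set of natural numbers, so messages are taken
  from \<^typ>\<open>nat\<close>. For \<open>X\<close> nonempty, \<open>W\<close> state-valued and \<open>0 \<le> \<epsilon> < 1\<close> the sizes of the admissible
  codes form a nonempty set bounded by \<open>d / (1 - \<epsilon>)\<close>, \<open>d\<close> the dimension, so a greatest one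
  exists.\<close>

definition max_code_size ::
  "'x set \<Rightarrow> ('x \<Rightarrow> complex ^ 'n ^ 'n) \<Rightarrow> real \<Rightarrow> nat" where
  "max_code_size X W \<epsilon> = (GREATEST k. \<exists>(M :: nat set) e Q.
     is_code X M e Q \<and> card M = k \<and> p_err W M e Q \<le> \<epsilon>)"

text \<open>Minimal type-II error over all tests whose success probability on \<open>\<rho>\<close> is at least \<open>\<alpha>\<close>. For
  states and \<open>\<alpha> \<le> 1\<close> the infimum is a minimum, since the set of tests is compact and contains
  the identity.\<close>

definition beta_ht :: "real \<Rightarrow> complex ^ 'n ^ 'n \<Rightarrow> complex ^ 'n ^ 'n \<Rightarrow> real" where
  "beta_ht \<alpha> \<rho> \<sigma> =
     Inf {Re (trace (Q ** \<sigma>)) | Q. psd Q \<and> psd (mat 1 - Q) \<and> \<alpha> \<le> Re (trace (Q ** \<rho>))}"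

text \<open>Logarithms are natural; every logarithmic quantity scales by the same factor under a change
  of base.\<close>

definition D_h :: "real \<Rightarrow> complex ^ 'n ^ 'n \<Rightarrow> complex ^ 'n ^ 'n \<Rightarrow> ereal" where
  "D_h \<epsilon> \<rho> \<sigma> =
     (if beta_ht (1 - \<epsilon>) \<rho> \<sigma> = 0 then \<infinity>
      else ereal (- ln (beta_ht (1 - \<epsilon>) \<rho> \<sigma> / (1 - \<epsilon>))))"

definition chi_h :: "real \<Rightarrow> (complex ^ 'n ^ 'n) set \<Rightarrow> ereal" where
  "chi_h \<epsilon> S = (INF \<sigma>\<in>states. SUP \<rho>\<in>S. D_h \<epsilon> \<rho> \<sigma>)"

end

theory Submission
  imports Defs
begin

text \<open>Fix a state \<open>\<sigma>\<close> and a code with error at most \<open>\<epsilon>\<close>. By Markov's inequality at least a fraction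
  \<open>\<mu> / (\<epsilon> + \<mu>)\<close> of the messages \<open>m\<close> is decoded with success probability at least \<open>1 - \<epsilon> - \<mu>\<close>. For
  these, \<open>Q m\<close> is an admissible test of \<open>W (e m)\<close> against \<open>\<sigma>\<close>, so that \<open>tr (Q m \<sigma>)\<close> is at least
  \<open>(1 - \<epsilon> - \<mu>) exp (- D)\<close>, with \<open>D\<close> the supremum of the divergences to \<open>\<sigma>\<close>. As the numbers
  \<open>tr (Q m \<sigma>)\<close> sum to \<open>tr \<sigma> = 1\<close>, the number of messages is bounded as claimed.\<close>

section \<open>Positive semidefinite matrices\<close>

lemma cinner_add_left: "cinner (u + v) w = cinner u w + cinner v w"
  by (simp add: cinner_def algebra_simps sum.distrib)

lemma cinner_add_right: "cinner u (v + w) = cinner u v + cinner u w"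
  by (simp add: cinner_def algebra_simps sum.distrib)

lemma cinner_diff_left: "cinner (u - v) w = cinner u w - cinner v w"
  by (simp add: cinner_def algebra_simps sum_subtractf)

lemma cinner_diff_right: "cinner u (v - w) = cinner u v - cinner u w"
  by (simp add: cinner_def algebra_simps sum_subtractf)

lemma cinner_scale_left: "cinner (c *s u) w = cnj c * cinner u w"
  by (simp add: cinner_def algebra_simps sum_distrib_left)

lemma cinner_scale_right: "cinner u (c *s w) = c * cinner u w"
  by (simp add: cinner_def algebra_simps sum_distrib_left)

lemmas cinner_linear = cinner_add_left cinner_add_right cinner_diff_left cinner_diff_right
  cinner_scale_left cinner_scale_right

lemma cinner_axis_left: "cinner (axis i 1) w = w $ i"
proof -
  have "cinner (axis i 1) w = (\<Sum>j\<in>UNIV. if j = i then w $ j else 0)"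
    unfolding cinner_def by (rule sum.cong) (auto simp: axis_def)
  then show ?thesis by simp
qed

lemma cinner_commute: "cinner v w = cnj (cinner w v)"
  by (simp add: cinner_def mult.commute)

lemma matrix_vector_mult_axis: "(A *v axis j 1) $ i = (A :: complex ^ 'n ^ 'm) $ i $ j"
  by (simp add: matrix_vector_mult_def axis_def if_distrib cong: if_cong)

lemma cinner_axis_matrix: "cinner (axis i 1) (A *v axis j 1) = A $ i $ j"
  by (simp add: cinner_axis_left matrix_vector_mult_axis)

lemma psd_iff: "psd A \<longleftrightarrow> (\<forall>v. Re (cinner v (A *v v)) \<ge> 0 \<and> Im (cinner v (A *v v)) = 0)"
  by (simp add: psd_def complex_nonneg_Reals_iff)

lemma trace_zero: "trace 0 = 0"
  by (simp add: trace_def)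

lemma psd_zero: "psd 0"
  by (simp add: psd_iff cinner_def)

lemma psd_one: "psd (mat 1)"
  by (auto simp: psd_iff cinner_def intro!: sum_nonneg)

lemma psd_add: "psd A \<Longrightarrow> psd B \<Longrightarrow> psd (A + B)"
  by (simp add: psd_iff matrix_vector_mult_add_rdistrib cinner_linear)

lemma psd_sum: "(\<And>m. m \<in> M \<Longrightarrow> psd (Q m)) \<Longrightarrow> psd (\<Sum>m\<in>M. Q m)"
  by (induction M rule: infinite_finite_induct) (auto intro: psd_add psd_zero)

text \<open>By polarization.\<close>

lemma psd_form_commute:
  assumes "psd A"
  shows "cinner v (A *v w) = cnj (cinner w (A *v v))"
proof -
  have im: "Im (cinner z (A *v z)) = 0" for z
    using assms by (simp add: psd_iff)
  have "Im (cinner v (A *v w)) + Im (cinner w (A *v v)) = 0"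
    using im[of "v + w"] im[of v] im[of w]
    by (simp add: matrix_vector_right_distrib cinner_linear)
  \<comment> \<open>The cross terms at \<open>v + \<i> *s w\<close> are \<i> times the difference of
    the two forms, so their imaginary part is the difference of the real parts.\<close>
  moreover have "Re (cinner v (A *v w)) - Re (cinner w (A *v v)) = 0"
    using im[of "v + \<i> *s w"] im[of v] im[of w]
    by (simp add: matrix_vector_right_distrib vector_scalar_commute cinner_linear)
  ultimately show ?thesis
    by (simp add: complex_eq_iff)
qed

lemma psd_hermitian: "psd A \<Longrightarrow> A $ i $ j = cnj (A $ j $ i)"
  using psd_form_commute[of A "axis i 1" "axis j 1"] by (simp add: cinner_axis_matrix)

lemma psd_diag:
  assumes "psd A"
  shows "Re (A $ i $ i) \<ge> 0" "Im (A $ i $ i) = 0"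
  using assms unfolding psd_iff by (metis cinner_axis_matrix)+

lemma psd_diag_zero_imp_zero:
  assumes "psd A" and d: "\<And>i. A $ i $ i = 0"
  shows "A = 0"
proof -
  have "A $ i $ j = 0" for i j
  proof -
    \<comment> \<open>With zero diagonal only cross terms survive; this \<open>?t\<close> gives both
      of them the value -|A_ij|^2, which positivity forbids unless it is zero.\<close>
    let ?t = "- (A $ j $ i)"
    let ?v = "axis i 1 + ?t *s axis j 1"
    have "cinner ?v (A *v ?v) = ?t * A $ i $ j + cnj ?t * A $ j $ i"
      by (simp add: matrix_vector_right_distrib matrix_vector_mult_diff_distrib
          vector_scalar_commute cinner_linear cinner_axis_matrix d)
    also have "\<dots> = - 2 * (A $ i $ j * cnj (A $ i $ j))"
      using psd_hermitian[OF assms(1), of j i] by simp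
    also have "\<dots> = complex_of_real (- 2 * (norm (A $ i $ j))\<^sup>2)"
      by (simp flip: complex_norm_square)
    finally have "Re (complex_of_real (- 2 * (norm (A $ i $ j))\<^sup>2)) \<ge> 0"
      using assms(1) unfolding psd_iff by metis
    then show ?thesis
      by (simp del: of_real_mult of_real_power)
  qed
  then show ?thesis by (simp add: vec_eq_iff)
qed

section \<open>Rank-one operators |b><b| and traces of products\<close>

definition outer :: "complex ^ 'n \<Rightarrow> complex ^ 'n ^ 'n" where
  "outer b = (\<chi> i j. b $ i * cnj (b $ j))"

lemma outer_mult_vector: "outer b *v v = cinner b v *s b"
  by (simp add: outer_def matrix_vector_mult_def cinner_def vec_eq_iff sum_distrib_left
      sum_distrib_right mult_ac)

lemma trace_mult_outer: "trace (A ** outer b) = cinner b (A *v b)"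
  by (simp add: trace_def outer_def matrix_matrix_mult_def matrix_vector_mult_def cinner_def
      sum_distrib_left sum_distrib_right mult_ac)

text \<open>A Gram-Schmidt step for the semi-inner product given by \<open>B\<close>: the new form
  at \<open>v\<close> is the old form at \<open>v\<close> minus its component along the unit vector
  \<open>u\<close>.\<close>

lemma psd_minus_outer:
  assumes "psd B" and u: "cinner u (B *v u) = 1"
  shows "psd (B - outer (B *v u))"
proof -
  have "cinner v ((B - outer (B *v u)) *v v) =
      cinner (v - cinner u (B *v v) *s u) (B *v (v - cinner u (B *v v) *s u))" for v
  proof -
    have "cinner v (B *v u) = cnj (cinner u (B *v v))"
      and "cinner (B *v u) v = cinner u (B *v v)"
      using psd_form_commute[OF assms(1)] cinner_commute by metis+
    then show ?thesis
      by (simp add: matrix_vector_mult_diff_rdistrib matrix_vector_mult_diff_distrib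
          vector_scalar_commute cinner_linear outer_mult_vector u)
  qed
  then show ?thesis
    using assms(1) by (simp add: psd_iff)
qed

text \<open>One Cholesky step removes a rank-one part of \<open>B\<close> and clears a diagonal entry.\<close>

lemma trace_mult_psd_nonneg:
  assumes A: "psd A" and B: "psd B"
  shows "Re (trace (A ** B)) \<ge> 0"
  using B
proof (induction "card {i. B $ i $ i \<noteq> 0}" arbitrary: B rule: less_induct)
  case less
  show ?case
  proof (cases "\<forall>i. B $ i $ i = 0")
    case True
    then show ?thesis
      using psd_diag_zero_imp_zero[OF less.prems] by (simp add: trace_zero)
  next
    case False
    then obtain i where i: "B $ i $ i \<noteq> 0" by blast
    define d where "d = Re (B $ i $ i)"
    have Bii: "B $ i $ i = complex_of_real d"
      using psd_diag[OF less.prems, of i] by (simp add: d_def complex_eq_iff)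
    have d: "d > 0"
      using psd_diag(1)[OF less.prems, of i] i unfolding Bii by simp
    have dd: "complex_of_real (sqrt d) * complex_of_real (sqrt d) = complex_of_real d"
      using d by (simp flip: of_real_mult)
    \<comment> \<open>The \<open>i\<close>-th basis vector, normalized in the form of
      \<open>B\<close>.\<close>
    define u :: "complex ^ 'a" where "u = complex_of_real (1 / sqrt d) *s axis i 1"
    define B' where "B' = B - outer (B *v u)"
    have u: "cinner u (B *v u) = 1"
      using d dd by (simp add: u_def vector_scalar_commute cinner_linear cinner_axis_matrix Bii
          field_simps)
    have B': "psd B'"
      unfolding B'_def by (rule psd_minus_outer[OF less.prems u])
    have entry: "B' $ j $ j = B $ j $ j - complex_of_real ((norm ((B *v u) $ j))\<^sup>2)" for j
      by (simp add: B'_def outer_def flip: complex_norm_square)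
    have "(B *v u) $ i = complex_of_real (sqrt d)"
      using d dd by (simp add: u_def vector_scalar_commute matrix_vector_mult_axis Bii
          field_simps)
    then have "B' $ i $ i = 0"
      using d by (simp add: entry Bii flip: of_real_power)
    \<comment> \<open>Diagonal entries can only decrease, yet stay nonnegative since
      \<open>B'\<close> is positive semidefinite; hence zeros persist.\<close>
    moreover have "B' $ j $ j = 0" if "B $ j $ j = 0" for j
      using psd_diag[OF B', of j] that by (simp add: entry complex_eq_iff del: of_real_power)
    ultimately have "{j. B' $ j $ j \<noteq> 0} \<subset> {j. B $ j $ j \<noteq> 0}"
      using i by blast
    then have "card {j. B' $ j $ j \<noteq> 0} < card {j. B $ j $ j \<noteq> 0}"
      by (intro psubset_card_mono) auto
    from less.hyps[OF this B'] have "Re (trace (A ** B')) \<ge> 0" .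
    moreover have "Re (trace (A ** outer (B *v u))) \<ge> 0"
      using A by (simp add: trace_mult_outer psd_iff)
    moreover have "trace (A ** B) = trace (A ** B') + trace (A ** outer (B *v u))"
      by (simp add: B'_def flip: trace_add matrix_add_ldistrib)
    ultimately show ?thesis by simp
  qed
qed

lemma Re_trace_psd_mult_le:
  assumes "psd A" "psd (mat 1 - Q)"
  shows "Re (trace (A ** Q)) \<le> Re (trace A)"
proof -
  have "trace A = trace (A ** (mat 1 - Q)) + trace (A ** Q)"
    by (simp flip: trace_add matrix_add_ldistrib)
  then show ?thesis
    using trace_mult_psd_nonneg[OF assms] by simp
qed

section \<open>Trace distance zero and the closure of a set of states\<close>

lemma psd_square_eq_zero:
  assumes "psd B" "B ** B = 0"
  shows "B = 0"
proof -
  have "B $ i $ j = 0" for i j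
  proof -
    \<comment> \<open>As \<open>B\<close> is Hermitian, the diagonal of its square holds the squared
      norms of its rows.\<close>
    have "complex_of_real (\<Sum>k\<in>UNIV. (norm (B $ i $ k))\<^sup>2) = (\<Sum>k\<in>UNIV. B $ i $ k * B $ k $ i)"
      unfolding of_real_sum complex_norm_square
      using psd_hermitian[OF assms(1)] by (intro sum.cong refl) metis
    also have "\<dots> = (B ** B) $ i $ i"
      by (simp add: matrix_matrix_mult_def)
    finally have "(\<Sum>k\<in>UNIV. (norm (B $ i $ k))\<^sup>2) = 0"
      using assms(2) by (simp del: of_real_sum)
    then show ?thesis
      by (simp add: sum_nonneg_eq_0_iff)
  qed
  then show ?thesis by (simp add: vec_eq_iff)
qed

lemma psd_sqrt_zero: "psd_sqrt 0 = 0"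
  unfolding psd_sqrt_def
  by (rule the_equality) (auto simp: psd_zero intro: psd_square_eq_zero)

text \<open>Every state is at distance zero from itself. Hence a supremum over the closure bounds
  the divergence at each channel output.\<close>

lemma subset_state_closure:
  assumes "S \<subseteq> states"
  shows "S \<subseteq> state_closure S"
proof -
  have "trace_dist \<rho> \<rho> = 0" for \<rho> :: "complex ^ 'a ^ 'a"
    by (simp add: trace_dist_def trace_norm_def psd_sqrt_zero trace_zero)
  then show ?thesis
    using assms unfolding state_closure_def by (smt (verit) mem_Collect_eq subset_iff)
qed

section \<open>Hypothesis testing and codes\<close>

lemma beta_ht_lower:
  assumes "psd \<sigma>" "psd Q" "psd (mat 1 - Q)" "\<alpha> \<le> Re (trace (Q ** \<rho>))"
  shows "beta_ht \<alpha> \<rho> \<sigma> \<le> Re (trace (Q ** \<sigma>))"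
  unfolding beta_ht_def
proof (rule cInf_lower)
  show "bdd_below {Re (trace (Q ** \<sigma>)) |Q. psd Q \<and> psd (mat 1 - Q) \<and> \<alpha> \<le> Re (trace (Q ** \<rho>))}"
    using trace_mult_psd_nonneg[OF _ assms(1)] by (auto intro: bdd_belowI[of _ 0])
qed (use assms in blast)

lemma beta_ht_nonneg:
  assumes "psd \<sigma>" "\<alpha> \<le> Re (trace \<rho>)"
  shows "0 \<le> beta_ht \<alpha> \<rho> \<sigma>"
  unfolding beta_ht_def
proof (rule cInf_greatest)
  \<comment> \<open>The identity is an admissible test, so the infimum is over a nonempty set and
    inherits the lower bound 0.\<close>
  have "psd (mat 1)" "psd (mat 1 - mat 1)" "\<alpha> \<le> Re (trace (mat 1 ** \<rho>))"
    using assms by (auto simp: psd_one psd_zero)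
  then show "{Re (trace (Q ** \<sigma>)) |Q. psd Q \<and> psd (mat 1 - Q) \<and> \<alpha> \<le> Re (trace (Q ** \<rho>))} \<noteq> {}"
    by blast
qed (use trace_mult_psd_nonneg[OF _ assms(1)] in auto)

lemma beta_ht_ge_of_D_h_le:
  assumes "psd \<sigma>" "\<rho> \<in> states" "0 \<le> \<delta>" "\<delta> < 1" "D_h \<delta> \<rho> \<sigma> \<le> ereal D"
  shows "(1 - \<delta>) * exp (- D) \<le> beta_ht (1 - \<delta>) \<rho> \<sigma>"
proof -
  \<comment> \<open>A zero error would make the divergence infinite, against the real bound
    \<open>D\<close>.\<close>
  have nz: "beta_ht (1 - \<delta>) \<rho> \<sigma> \<noteq> 0"
    using assms(5) by (auto simp: D_h_def)
  moreover have "0 \<le> beta_ht (1 - \<delta>) \<rho> \<sigma>"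
    using assms by (intro beta_ht_nonneg) (auto simp: states_def)
  ultimately have pos: "0 < beta_ht (1 - \<delta>) \<rho> \<sigma> / (1 - \<delta>)"
    using assms(4) by simp
  have "- D \<le> ln (beta_ht (1 - \<delta>) \<rho> \<sigma> / (1 - \<delta>))"
    using assms(5) nz by (simp add: D_h_def)
  then have "exp (- D) \<le> beta_ht (1 - \<delta>) \<rho> \<sigma> / (1 - \<delta>)"
    using pos by (simp add: ln_ge_iff)
  then show ?thesis
    using assms(4) by (simp add: field_simps)
qed

section \<open>Decoding measurements and the size of codes\<close>

lemma is_povm_le_one:
  assumes "finite M" "is_povm M Q" "m \<in> M"
  shows "psd (mat 1 - Q m)"
proof -
  have "mat 1 - Q m = (\<Sum>k\<in>M - {m}. Q k)"
    using assms by (simp add: is_povm_def sum_diff1)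
  moreover have "psd (\<Sum>k\<in>M - {m}. Q k)"
    using assms by (intro psd_sum) (auto simp: is_povm_def)
  ultimately show ?thesis by simp
qed

lemma trace_sum_matrix: "trace (\<Sum>m\<in>M. Q m) = (\<Sum>m\<in>M. trace (Q m :: complex ^ 'n ^ 'n))"
  by (induction M rule: infinite_finite_induct) (auto simp: trace_add trace_zero)

lemma is_povm_sum_trace:
  assumes "is_povm M Q"
  shows "(\<Sum>m\<in>M. Re (trace (Q m ** \<sigma>))) = Re (trace \<sigma>)"
proof -
  have "(\<Sum>m\<in>M. Q m ** \<sigma>) = (\<Sum>m\<in>M. Q m) ** \<sigma>"
    by (induction M rule: infinite_finite_induct) (auto simp: matrix_matrix_mult_def vec_eq_iff algebra_simps sum.distrib)
  then show ?thesis
    using assms by (simp add: is_povm_def flip: Re_sum trace_sum_matrix)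
qed

text \<open>The converse bound for one fixed \<open>\<sigma>\<close>, in exponentiated form. Any
  real bound \<open>D\<close> on the divergences at the channel outputs is allowed.\<close>

lemma card_code_le:
  assumes code: "is_code X M e Q" and err: "p_err W M e Q \<le> \<epsilon>"
    and W: "W \<in> X \<rightarrow> states" and \<sigma>: "\<sigma> \<in> states"
    and "0 < \<epsilon>" "0 < \<mu>" "\<mu> < 1 - \<epsilon>"
    and D: "\<And>x. x \<in> X \<Longrightarrow> D_h (\<epsilon> + \<mu>) (W x) \<sigma> \<le> ereal D"
  shows "real (card M) \<le> exp D * ((\<epsilon> + \<mu>) / (\<mu> * (1 - \<epsilon> - \<mu>)))"
proof -
  have e: "e m \<in> X" if "m \<in> M" for m
    using code that by (auto simp: is_code_def)
  have finM: "finite M" and neM: "M \<noteq> {}" and povm: "is_povm M Q"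
    using code by (auto simp: is_code_def)
  have psdQ: "psd (Q m)" if "m \<in> M" for m
    using povm that by (simp add: is_povm_def)
  have st: "W (e m) \<in> states" if "m \<in> M" for m
    using W e[OF that] by blast
  have psd\<sigma>: "psd \<sigma>"
    using \<sigma> by (simp add: states_def)
  define s where "s m = Re (trace (W (e m) ** Q m))" for m
  define G where "G = {m \<in> M. 1 - \<epsilon> - \<mu> \<le> s m}"
  have finG: "finite G" and GM: "G \<subseteq> M"
    using finM by (auto simp: G_def)
  have s1: "s m \<le> 1" if "m \<in> M" for m
    using Re_trace_psd_mult_le[OF _ is_povm_le_one[OF finM povm that], of "W (e m)"] st[OF that]
    by (simp add: s_def states_def)
  have cardM: "0 < real (card M)"
    using finM neM by (simp add: card_gt_0_iff)
  have "(1 - \<epsilon>) * card M \<le> (\<Sum>m\<in>M. s m)"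
    using err cardM by (simp add: p_err_def s_def field_simps)
  \<comment> \<open>Markov's inequality by hand: outside \<open>G\<close> the success probability is
    below the threshold, and inside it is at most 1, which is the threshold plus
    \<open>\<epsilon> + \<mu>\<close>.\<close>
  also have "\<dots> \<le> (\<Sum>m\<in>M. (1 - \<epsilon> - \<mu>) + (if m \<in> G then \<epsilon> + \<mu> else 0))"
    using s1 by (intro sum_mono) (auto simp: G_def)
  also have "\<dots> = (1 - \<epsilon> - \<mu>) * card M + (\<epsilon> + \<mu>) * card G"
    using finM GM by (simp add: sum.distrib inf.absorb2 flip: sum.inter_restrict)
  finally have markov: "\<mu> * card M \<le> (\<epsilon> + \<mu>) * card G"
    by (simp add: algebra_simps)
  have "card G * ((1 - \<epsilon> - \<mu>) * exp (- D)) \<le> (\<Sum>m\<in>G. Re (trace (Q m ** \<sigma>)))"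
  proof (rule sum_bounded_below)
    fix m assume m: "m \<in> G"
    then have mM: "m \<in> M"
      using GM by blast
    have "(1 - (\<epsilon> + \<mu>)) * exp (- D) \<le> beta_ht (1 - (\<epsilon> + \<mu>)) (W (e m)) \<sigma>"
      using assms e[OF mM] st[OF mM] psd\<sigma> by (intro beta_ht_ge_of_D_h_le) auto
    also have "\<dots> \<le> Re (trace (Q m ** \<sigma>))"
      using m by (intro beta_ht_lower psd\<sigma> psdQ[OF mM] is_povm_le_one[OF finM povm mM])
        (simp add: G_def s_def trace_mul_sym[of "Q m" "W (e m)"])
    finally show "(1 - \<epsilon> - \<mu>) * exp (- D) \<le> Re (trace (Q m ** \<sigma>))"
      by (simp add: algebra_simps)
  qed
  also have "\<dots> \<le> (\<Sum>m\<in>M. Re (trace (Q m ** \<sigma>)))"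
    using finM GM psdQ psd\<sigma> by (intro sum_mono2) (auto intro: trace_mult_psd_nonneg)
  also have "\<dots> = 1"
    using \<sigma> by (simp add: is_povm_sum_trace[OF povm] states_def)
  finally have "card G * (1 - \<epsilon> - \<mu>) \<le> exp D"
    by (simp add: exp_minus field_simps)
  \<comment> \<open>The upper bound on \<open>card G\<close> and the lower bound from
    \<open>markov\<close> are scaled to a common middle term, which eliminates
    \<open>card G\<close>.\<close>
  then have "(\<epsilon> + \<mu>) * (card G * (1 - \<epsilon> - \<mu>)) \<le> (\<epsilon> + \<mu>) * exp D"
    using assms by (intro mult_left_mono) auto
  moreover have "\<mu> * card M * (1 - \<epsilon> - \<mu>) \<le> (\<epsilon> + \<mu>) * card G * (1 - \<epsilon> - \<mu>)"
    using markov assms by (intro mult_right_mono) auto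
  ultimately have "card M * (\<mu> * (1 - \<epsilon> - \<mu>)) \<le> exp D * (\<epsilon> + \<mu>)"
    by (simp only: mult_ac)
  then show ?thesis
    using assms by (simp add: pos_le_divide_eq)
qed

lemma trivial_code:
  assumes "x \<in> X" "W x \<in> states" "0 \<le> \<epsilon>"
  shows "is_code X {0 :: nat} (\<lambda>_. x) (\<lambda>_. mat 1) \<and> p_err W {0 :: nat} (\<lambda>_. x) (\<lambda>_. mat 1) \<le> \<epsilon>"
  using assms by (simp add: is_code_def is_povm_def p_err_def states_def psd_one)

text \<open>\<open>GREATEST\<close> denotes a maximum only for a nonempty bounded set of sizes: the
  one-message code gives nonemptiness, and \<open>b\<close> is the bound.\<close>

lemma max_code_size_attained:
  assumes "x \<in> X" "W x \<in> states" "0 \<le> \<epsilon>"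
    and bound: "\<And>(M :: nat set) e Q. is_code X M e Q \<Longrightarrow> p_err W M e Q \<le> \<epsilon> \<Longrightarrow> card M \<le> b"
  obtains M :: "nat set" and e Q
  where "is_code X M e Q" "p_err W M e Q \<le> \<epsilon>" "card M = max_code_size X W \<epsilon>"
proof -
  let ?P = "\<lambda>k. \<exists>(M :: nat set) e Q. is_code X M e Q \<and> card M = k \<and> p_err W M e Q \<le> \<epsilon>"
  have "?P (card {0 :: nat})"
    using trivial_code[of x X W \<epsilon>] assms(1-3) by blast
  then have "?P (Greatest ?P)"
    by (rule GreatestI_nat[where b = b]) (use bound in blast)
  then show thesis
    using that unfolding max_code_size_def by blast
qed

theorem proposition5:
  fixes X :: "'x set"
    and W :: "'x \<Rightarrow> complex ^ 'n ^ 'n"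
    and \<epsilon> \<mu> :: real
  assumes "0 < \<epsilon>" and "\<epsilon> < 1"
    and "X \<noteq> {}"
    and "W \<in> X \<rightarrow> states"
    and "0 < \<mu>" and "\<mu> < 1 - \<epsilon>"
  shows "ereal (ln (real (max_code_size X W \<epsilon>)))
      \<le> chi_h (\<epsilon> + \<mu>) (state_closure (W ` X))
         + ereal (ln ((\<epsilon> + \<mu>) / (\<mu> * (1 - \<epsilon> - \<mu>))))"
proof -
  let ?S = "state_closure (W ` X)"
  let ?c = "(\<epsilon> + \<mu>) / (\<mu> * (1 - \<epsilon> - \<mu>))"
  have c: "?c > 0"
    using assms by simp
  obtain x where x: "x \<in> X"
    using assms(3) by blast
  have cl: "W y \<in> ?S" if "y \<in> X" for y
    using subset_state_closure[of "W ` X"] assms(4) that by blast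
  have "ereal (ln (real (max_code_size X W \<epsilon>)) - ln ?c) \<le> (SUP \<rho>\<in>?S. D_h (\<epsilon> + \<mu>) \<rho> \<sigma>)"
    if \<sigma>: "\<sigma> \<in> states" for \<sigma>
  \<comment> \<open>It suffices to compare with every real upper bound \<open>D\<close> of the
    supremum; if the supremum is infinite, there is none.\<close>
  proof (rule ereal_le_real)
    fix D
    assume "(SUP \<rho>\<in>?S. D_h (\<epsilon> + \<mu>) \<rho> \<sigma>) \<le> ereal D"
    then have D: "D_h (\<epsilon> + \<mu>) (W y) \<sigma> \<le> ereal D" if "y \<in> X" for y
      using cl[OF that] by (meson SUP_upper order_trans)
    note bound = card_code_le[OF _ _ assms(4) \<sigma> assms(1,5,6) D]
    \<comment> \<open>The bound serves twice: rounded down, it shows that a largest code exists;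
      then it is applied to that code.\<close>
    have "card M \<le> nat \<lfloor>exp D * ?c\<rfloor>" if "is_code X M e Q" "p_err W M e Q \<le> \<epsilon>"
      for M :: "nat set" and e Q
      using bound[OF that] by (simp add: le_nat_floor)
    then obtain M :: "nat set" and e Q
      where M: "is_code X M e Q" "p_err W M e Q \<le> \<epsilon>" "card M = max_code_size X W \<epsilon>"
      using max_code_size_attained[of x X W \<epsilon>] x assms(1,4) by (metis PiE less_imp_le)
    \<comment> \<open>Positivity of the size makes \<open>ln\<close> monotone here.\<close>
    have "0 < card M"
      using M(1) by (simp add: is_code_def card_gt_0_iff)
    then have "ln (real (card M)) \<le> ln (exp D * ?c)"
      using bound[OF M(1,2)] by (intro ln_mono) auto
    also have "\<dots> = D + ln ?c"
      using c by (simp only: ln_mult_pos exp_gt_zero ln_exp)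
    finally show "ereal (ln (real (max_code_size X W \<epsilon>)) - ln ?c) \<le> ereal D"
      using M(3) by simp
  qed
  then have "ereal (ln (real (max_code_size X W \<epsilon>)) - ln ?c) \<le> chi_h (\<epsilon> + \<mu>) ?S"
    unfolding chi_h_def by (intro INF_greatest)
  \<comment> \<open>Since \<open>ln ?c\<close> is finite, it can be moved back across the inequality
    even if \<open>chi_h\<close> is infinite.\<close>
  then have "ereal (ln (real (max_code_size X W \<epsilon>)) - ln ?c) + ereal (ln ?c)
      \<le> chi_h (\<epsilon> + \<mu>) ?S + ereal (ln ?c)"
    by (rule add_right_mono)
  then show ?thesis
    by simp
qed

end
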